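(* Consider the F-RAN system described in the context, with fronthaul rate $r>0$ and fractional cache size $\mu=0$. Then the minimum NDT (serial fronthaul-edge transmission) satisfies $$\delta^*(0,r)\le \delta_F(m(r))+\delta_E(m(r)),\qquad \delta_F(m)=\frac{K_R m}{K_T r},\qquad \delta_E(m)=\frac{K_R}{\min\{m n_T,K_R\}},$$ where $$m(r)=\begin{cases}\Big[\sqrt{K_T r/n_T}\,\Big], & r<r_{th},\\ m_{max}, & r\ge r_{th},\end{cases}\qquad r_{th}=\frac{n_T}{K_T}m_{max}^2,\qquad m_{max}=\min\{K_T,\lceil K_R/n_T\rceil\},$$ and $[x]$ denotes the nearest positive integer to $x$.
   Context: F-RAN model. $K_T,K_R,n_T\ge 1$ and $N\ge K_R$ are integers; $[K]=\{1,\dots,K\}$. There are $K_T$ edge nodes (ENs) with $n_T$ antennas each, $K_R$ single-antenna users, and a cloud with a library of $N$ files $W_1,\dots,W_N$ of equal size. Each file is split into $F\ge 1$ equal packets, $\mathcal W_n=\{W_{n1},\dots,W_{nF}\}$ ($F$ is a free design parameter). $\mu\in[0,1]$ is the fractional cache size and $r\ge 0$ the fronthaul rate (each fronthaul link has capacity $r\log P$ bits per channel use, $P$ = SNR). Caching: EN $i$ stores sets $\mathcal C_{in}\subseteq\mathcal W_n$ with $|\mathcal C_{in}|\le \mu F$ for every $n$, chosen before the requests are known; $\mathcal C_i=\bigcup_n\mathcal C_{in}$. Delivery: user $k$ requests file $d_k\in[N]$; $\boldsymbol d=(d_1,\dots,d_{K_R})$. The cloud sends to EN $i$ a set $\mathcal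 F_i$ of (uncoded) packets of requested files. Then edge transmission takes place in $B$ blocks by one-shot linear precoding: in each block $b$ a set $\mathcal R(b)\subseteq[K_R]$ of users is served, each $k\in\mathcal R(b)$ with exactly one packet of $W_{d_k}$; the stream for user $k$ is sent with precoding vectors $\boldsymbol v_{i,k}\in\mathbb C^{n_T}$ by those ENs $i$ whose set $\mathcal C_i\cup\mathcal F_i$ contains that packet (the other ENs use $\boldsymbol v_{i,k}=0$); decodability without interference means $\sum_i \boldsymbol h_{ki}^T\boldsymbol v_{i,k}\ne 0$ and $\sum_i \boldsymbol h_{k'i}^T\boldsymbol v_{i,k}=0$ for all $k'\in\mathcal R(b)\setminus\{k\}$, where $\boldsymbol h_{ki}=\boldsymbol h_{ki}(b)\in\mathbb C^{n_T}$ is the channel from EN $i$ to user $k$. After the $B$ blocks every user must have received all $F$ packets of its file. The fronthaul sets and the edge transmission may depend on $\boldsymbol d$ and on the channels. The channels are arbitrary but non-degenerate: in each block, every square submatrix of the $K_R\times K_Tn_T$ matrix with rows $(\boldsymbol h_{k1}^T,\dots,\boldsymbol h_{kK_T}^T)$ is invertible. NDT (serial mode): for a policy and request $\boldsymbol d$, the fronthaul NDT is $\max_i|\mathcal F_i|/(Fr)$ (if $r=0$, nothing may be sent on the fronthaul and this is $0$), the edge NDT is $B/F$, and the NDT of the policy is the maximum over $\boldsymbol d$ of their sum. $\bar\delta(\mu,r)$ is the infimum of the NDT over all $F\ge1$ and all policies ($+\infty$ if there is none), and the minimum NDT $\delta^*(\mu,r)$ is the lower convex envelope of $\bar\delta(\mu,r)$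 as a function of $\mu\in[0,1]$ for fixed $r$. In $[x]$, ties are broken by any fixed rule. *)

theory Defs
  imports
    "HOL-Library.Extended_Real"
    "HOL-Library.FuncSet"
    "Jordan_Normal_Form.DL_Submatrix"
begin

(* The index sets [K] are rendered as {..<K}. The pair (n, f) is the f-th packet of file n. *)
type_synonym packet = "nat \<times> nat"

definition file_packets :: "nat \<Rightarrow> nat \<Rightarrow> packet set" where
  "file_packets F n = {n} \<times> {..<F}"

definition requests :: "nat \<Rightarrow> nat \<Rightarrow> (nat \<Rightarrow> nat) set" where
  "requests K_R N = {..<K_R} \<rightarrow>\<^sub>E {..<N}"

(* h b k i is the channel vector from EN i to user k in block b. *)
type_synonym channels = "nat \<Rightarrow> nat \<Rightarrow> nat \<Rightarrow> complex vec"

definition channel_mat :: "nat \<Rightarrow> nat \<Rightarrow> nat \<Rightarrow> (nat \<Rightarrow> nat \<Rightarrow> complex vec) \<Rightarrow> complex mat" where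
  "channel_mat K_T K_R n_T h =
     mat K_R (K_T * n_T) (\<lambda>(k, j). h k (j div n_T) $ (j mod n_T))"

definition nondegenerate :: "nat \<Rightarrow> nat \<Rightarrow> nat \<Rightarrow> channels \<Rightarrow> bool" where
  "nondegenerate K_T K_R n_T h \<longleftrightarrow>
     (\<forall>b. (\<forall>k<K_R. \<forall>i<K_T. h b k i \<in> carrier_vec n_T) \<and>
          (\<forall>I J. I \<subseteq> {..<K_R} \<and> J \<subseteq> {..<K_T * n_T} \<and> I \<noteq> {} \<and> card I = card J \<longrightarrow>
             invertible_mat (submatrix (channel_mat K_T K_R n_T (h b)) I J)))"

(* Block b < num_blocks serves the users in served b; user k is sent the packet sent b k,
   with precoding vector precoder b i k at EN i. *)
record delivery =
  fronthaul :: "nat \<Rightarrow> packet set"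
  num_blocks :: nat
  served :: "nat \<Rightarrow> nat set"
  sent :: "nat \<Rightarrow> nat \<Rightarrow> packet"
  precoder :: "nat \<Rightarrow> nat \<Rightarrow> nat \<Rightarrow> complex vec"

(* The cache contents cache i n of EN i for file n are chosen before requests and channels are
   known, whereas the delivery may depend on both. *)
record policy =
  num_packets :: nat
  cache :: "nat \<Rightarrow> nat \<Rightarrow> packet set"
  deliver :: "(nat \<Rightarrow> nat) \<Rightarrow> channels \<Rightarrow> delivery"

definition valid_cache ::
  "nat \<Rightarrow> nat \<Rightarrow> real \<Rightarrow> nat \<Rightarrow> (nat \<Rightarrow> nat \<Rightarrow> packet set) \<Rightarrow> bool" where
  "valid_cache K_T N \<mu> F C \<longleftrightarrow>
     (\<forall>i<K_T. \<forall>n<N. C i n \<subseteq> file_packets F n \<and> real (card (C i n)) \<le> \<mu> * real F)"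

definition valid_fronthaul ::
  "nat \<Rightarrow> nat \<Rightarrow> real \<Rightarrow> nat \<Rightarrow> (nat \<Rightarrow> nat) \<Rightarrow> (nat \<Rightarrow> packet set) \<Rightarrow> bool" where
  "valid_fronthaul K_T K_R r F d Fh \<longleftrightarrow>
     (\<forall>i<K_T. Fh i \<subseteq> (\<Union>k<K_R. file_packets F (d k)) \<and> (r = 0 \<longrightarrow> Fh i = {}))"

(* A i is the set of packets available at EN i. The scalar product of complex vec does not
   conjugate, i.e. it is h^T v. *)
definition valid_block ::
  "nat \<Rightarrow> nat \<Rightarrow> nat \<Rightarrow> nat \<Rightarrow> (nat \<Rightarrow> nat) \<Rightarrow> (nat \<Rightarrow> nat \<Rightarrow> complex vec) \<Rightarrow> (nat \<Rightarrow> packet set)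
     \<Rightarrow> nat set \<Rightarrow> (nat \<Rightarrow> packet) \<Rightarrow> (nat \<Rightarrow> nat \<Rightarrow> complex vec) \<Rightarrow> bool" where
  "valid_block K_T K_R n_T F d h A R s v \<longleftrightarrow>
     R \<subseteq> {..<K_R} \<and>
     (\<forall>k\<in>R.
        s k \<in> file_packets F (d k) \<and>
        (\<forall>i<K_T. v i k \<in> carrier_vec n_T \<and> (s k \<notin> A i \<longrightarrow> v i k = 0\<^sub>v n_T)) \<and>
        (\<Sum>i<K_T. h k i \<bullet> v i k) \<noteq> 0 \<and>
        (\<forall>k'\<in>R - {k}. (\<Sum>i<K_T. h k' i \<bullet> v i k) = 0))"

definition valid_delivery ::
  "nat \<Rightarrow> nat \<Rightarrow> nat \<Rightarrow> nat \<Rightarrow> real \<Rightarrow> nat \<Rightarrow> (nat \<Rightarrow> nat \<Rightarrow> packet set)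
     \<Rightarrow> (nat \<Rightarrow> nat) \<Rightarrow> channels \<Rightarrow> delivery \<Rightarrow> bool" where
  "valid_delivery K_T K_R n_T N r F C d h D \<longleftrightarrow>
     valid_fronthaul K_T K_R r F d (fronthaul D) \<and>
     (\<forall>b<num_blocks D.
        valid_block K_T K_R n_T F d (h b) (\<lambda>i. (\<Union>n<N. C i n) \<union> fronthaul D i)
          (served D b) (sent D b) (precoder D b)) \<and>
     (\<forall>k<K_R. file_packets F (d k) \<subseteq> {sent D b k | b. b < num_blocks D \<and> k \<in> served D b})"

definition valid_policy ::
  "nat \<Rightarrow> nat \<Rightarrow> nat \<Rightarrow> nat \<Rightarrow> real \<Rightarrow> real \<Rightarrow> policy \<Rightarrow> bool" where
  "valid_policy K_T K_R n_T N r \<mu> p \<longleftrightarrow>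
     num_packets p \<ge> 1 \<and>
     valid_cache K_T N \<mu> (num_packets p) (cache p) \<and>
     (\<forall>d\<in>requests K_R N. \<forall>h. nondegenerate K_T K_R n_T h \<longrightarrow>
        valid_delivery K_T K_R n_T N r (num_packets p) (cache p) d h (deliver p d h))"

(* For r = 0 the fronthaul sets are empty, and 0 / 0 = 0 is the intended value. *)
definition fronthaul_NDT :: "nat \<Rightarrow> real \<Rightarrow> nat \<Rightarrow> delivery \<Rightarrow> real" where
  "fronthaul_NDT K_T r F D = real (MAX i\<in>{..<K_T}. card (fronthaul D i)) / (real F * r)"

definition edge_NDT :: "nat \<Rightarrow> delivery \<Rightarrow> real" where
  "edge_NDT F D = real (num_blocks D) / real F"

(* Worst case over the requests and over all non-degenerate channels. *)
definition policy_NDT :: "nat \<Rightarrow> nat \<Rightarrow> nat \<Rightarrow> nat \<Rightarrow> real \<Rightarrow> policy \<Rightarrow> ereal" where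
  "policy_NDT K_T K_R n_T N r p =
     (SUP d\<in>requests K_R N. SUP h\<in>{h. nondegenerate K_T K_R n_T h}.
        ereal (fronthaul_NDT K_T r (num_packets p) (deliver p d h)
               + edge_NDT (num_packets p) (deliver p d h)))"

definition NDT_bar :: "nat \<Rightarrow> nat \<Rightarrow> nat \<Rightarrow> nat \<Rightarrow> real \<Rightarrow> real \<Rightarrow> ereal" where
  "NDT_bar K_T K_R n_T N r \<mu> =
     (INF p\<in>{p. valid_policy K_T K_R n_T N r \<mu> p}. policy_NDT K_T K_R n_T N r p)"

definition ereal_convex_on :: "real set \<Rightarrow> (real \<Rightarrow> ereal) \<Rightarrow> bool" where
  "ereal_convex_on S g \<longleftrightarrow>
     (\<forall>x\<in>S. \<forall>y\<in>S. \<forall>t\<in>{0<..<1}.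
        g ((1 - t) * x + t * y) \<le> ereal (1 - t) * g x + ereal t * g y)"

definition lower_convex_envelope :: "real set \<Rightarrow> (real \<Rightarrow> ereal) \<Rightarrow> real \<Rightarrow> ereal" where
  "lower_convex_envelope S f x =
     (SUP g\<in>{g. ereal_convex_on S g \<and> (\<forall>y\<in>S. g y \<le> f y)}. g x)"

definition min_NDT :: "nat \<Rightarrow> nat \<Rightarrow> nat \<Rightarrow> nat \<Rightarrow> real \<Rightarrow> real \<Rightarrow> ereal" where
  "min_NDT K_T K_R n_T N \<mu> r = lower_convex_envelope {0..1} (NDT_bar K_T K_R n_T N r) \<mu>"

definition nearest_pos_int :: "real \<Rightarrow> nat \<Rightarrow> bool" where
  "nearest_pos_int x m \<longleftrightarrow> is_arg_min (\<lambda>j. \<bar>x - real j\<bar>) (\<lambda>j. j \<ge> 1) m"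

definition m_max :: "nat \<Rightarrow> nat \<Rightarrow> nat \<Rightarrow> nat" where
  "m_max K_T K_R n_T = min K_T (nat \<lceil>real K_R / real n_T\<rceil>)"

definition r_th :: "nat \<Rightarrow> nat \<Rightarrow> nat \<Rightarrow> real" where
  "r_th K_T K_R n_T = real n_T / real K_T * (real (m_max K_T K_R n_T))\<^sup>2"

(* rnd is the rounding x |-> [x], including its tie-breaking rule. *)
definition m_opt :: "(real \<Rightarrow> nat) \<Rightarrow> nat \<Rightarrow> nat \<Rightarrow> nat \<Rightarrow> real \<Rightarrow> nat" where
  "m_opt rnd K_T K_R n_T r =
     (if r < r_th K_T K_R n_T then rnd (sqrt (real K_T * r / real n_T))
      else m_max K_T K_R n_T)"

definition delta_F :: "nat \<Rightarrow> nat \<Rightarrow> real \<Rightarrow> nat \<Rightarrow> real" where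
  "delta_F K_T K_R r m = real K_R * real m / (real K_T * r)"

definition delta_E :: "nat \<Rightarrow> nat \<Rightarrow> nat \<Rightarrow> real" where
  "delta_E K_R n_T m = real K_R / real (min (m * n_T) K_R)"

end

theory Submission
  imports Defs
begin

text \<open>
  With an empty cache, take \<open>m\<close> with \<open>1 \<le> m \<le> K_T\<close>, set \<open>u = min (m n_T) K_R\<close> and split each file
  into \<open>F = K_T u\<close> packets. The fronthaul sends every requested packet to \<open>m\<close> cyclically consecutive
  ENs, so that each EN receives at most \<open>K_R m u\<close> packets. The \<open>K_R F\<close> pairs of a user and a packet
  are delivered cyclically over the users, \<open>u\<close> of them per block. Each stream can be zero-forced at
  the other \<open>u - 1\<close> users of its block because the \<open>m n_T \<ge> u\<close> antennas holding the packet contain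
  \<open>u\<close> antennas whose channel matrix to the served users is invertible. The value \<open>m_opt\<close> is an
  admissible \<open>m\<close>, and the convex envelope is at most the function itself.
\<close>

section \<open>Residues, ranks and square linear systems\<close>

lemma inj_on_mod_interval:
  fixes a u K :: nat
  assumes "u \<le> K"
  shows "inj_on (\<lambda>s. s mod K) {a..<a + u}"
proof -
  have *: "s = t" if "s \<le> t" "t < s + K" "s mod K = t mod K" for s t :: nat
  proof -
    have "K dvd t - s" using that by (metis mod_eq_dvd_iff_nat)
    moreover have "t - s < K" using that by linarith
    ultimately have "t - s = 0" by (meson nat_dvd_not_less neq0_conv)
    then show ?thesis using that by simp
  qed
  show ?thesis
  proof (rule inj_onI)
    fix s t assume st: "s \<in> {a..<a + u}" "t \<in> {a..<a + u}" "s mod K = t mod K"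
    then have "s < t + K" "t < s + K" using assms by auto
    then show "s = t"
      using *[of s t] *[of t s] st(3) by (metis nle_le)
  qed
qed

text \<open>\<open>pick J\<close> inverts the rank function, which is therefore injective, and
  \<open>j\<close> is not counted in its own rank, so ranks stay below \<open>card J\<close>. The
  bijection turns sums over the index range of a submatrix into sums over the original
  columns.\<close>

lemma bij_betw_card_less:
  fixes J :: "nat set"
  assumes "finite J"
  shows "bij_betw (\<lambda>j. card {a \<in> J. a < j}) J {..<card J}"
proof -
  let ?p = "\<lambda>j. card {a \<in> J. a < j}"
  have inj: "inj_on ?p J"
    by (rule inj_onI) (metis pick_card_in_set)
  have "?p ` J \<subseteq> {..<card J}"
    using assms by (auto intro!: psubset_card_mono)
  moreover have "card (?p ` J) = card {..<card J}"
    using card_image[OF inj] by simp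
  ultimately have "?p ` J = {..<card J}"
    by (simp add: card_subset_eq)
  with inj show ?thesis by (simp add: bij_betw_def)
qed

text \<open>Apply the inverse of the submatrix to the right-hand side listed in the order of
  \<open>I\<close>, then relabel the solution by the columns in \<open>J\<close>. Later proofs can
  thus use original row and column numbers only.\<close>

lemma submatrix_solve:
  fixes A :: "'a :: comm_ring_1 mat" and b :: "nat \<Rightarrow> 'a"
  assumes A: "A \<in> carrier_mat m n"
    and I: "I \<subseteq> {..<m}" and J: "J \<subseteq> {..<n}" and card: "card I = card J"
    and inv: "invertible_mat (submatrix A I J)"
  obtains x where "\<And>k. k \<in> I \<Longrightarrow> (\<Sum>j\<in>J. A $$ (k, j) * x j) = b k"
proof -
  let ?M = "submatrix A I J" and ?u = "card J"
  define pos where "pos S j = card {a \<in> S. a < j}" for S :: "nat set" and j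
  have fin: "finite I" "finite J" using I J finite_subset by auto
  have eqI: "{i. i < m \<and> i \<in> I} = I" and eqJ: "{j. j < n \<and> j \<in> J} = J"
    using I J by auto
  have M: "?M \<in> carrier_mat ?u ?u"
    using card carrier_matD[OF A] by (intro carrier_matI) (simp_all add: dim_submatrix eqI eqJ)
  obtain B where MB: "?M * B = 1\<^sub>m ?u" and BM: "B * ?M = 1\<^sub>m (dim_row B)"
    using inv M unfolding invertible_mat_def inverts_mat_def by auto
  \<comment> \<open>Invertibility leaves the dimensions of the inverse open; comparing column counts
    in both products fixes them.\<close>
  have B: "B \<in> carrier_mat ?u ?u"
    using arg_cong[OF MB, of dim_col] arg_cong[OF BM, of dim_col] M by (intro carrier_matI) auto
  define c where "c = vec ?u (\<lambda>p. b (pick I p))"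
  define y where "y = B *\<^sub>v c"
  have c: "c \<in> carrier_vec ?u" by (simp add: c_def)
  have y: "y \<in> carrier_vec ?u" unfolding y_def using B c by (rule mult_mat_vec_carrier)
  have My: "?M *\<^sub>v y = c"
    unfolding y_def using assoc_mult_mat_vec[OF M B c] MB c by simp
  have "(\<Sum>j\<in>J. A $$ (k, j) * y $ pos J j) = b k" if k: "k \<in> I" for k
  proof -
    have p: "pos I k < ?u"
      using bij_betwE[OF bij_betw_card_less[OF fin(1)]] k card by (auto simp: pos_def)
    have "b k = c $ pos I k"
      using p k by (simp add: c_def pos_def pick_card_in_set)
    also have "\<dots> = (\<Sum>q<?u. ?M $$ (pos I k, q) * y $ q)"
      unfolding My[symmetric] using M y p
      by (simp add: scalar_prod_def lessThan_atLeast0)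
    also have "\<dots> = (\<Sum>j\<in>J. ?M $$ (pos I k, pos J j) * y $ pos J j)"
      using sum.reindex_bij_betw[OF bij_betw_card_less[OF fin(2)],
          of "\<lambda>q. ?M $$ (pos I k, q) * y $ q"] by (simp add: pos_def)
    also have "\<dots> = (\<Sum>j\<in>J. A $$ (k, j) * y $ pos J j)"
    proof (rule sum.cong[OF refl])
      fix j assume "j \<in> J"
      then have "?M $$ (pos I k, pos J j) = A $$ (k, j)"
        unfolding pos_def using A I J k by (intro submatrix_index_card) auto
      then show "?M $$ (pos I k, pos J j) * y $ pos J j = A $$ (k, j) * y $ pos J j"
        by (simp only:)
    qed
    finally show ?thesis by (rule sym)
  qed
  then show ?thesis by (rule that)
qed

section \<open>Zero-forcing precoders\<close>

lemma zero_forcing: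
  assumes nd: "nondegenerate K_T K_R n_T h" and n: "n_T \<ge> 1"
    and R: "R \<subseteq> {..<K_R}" and k: "k \<in> R" and S: "S \<subseteq> {..<K_T}"
    and card: "card R \<le> card S * n_T"
  obtains v where "\<And>i. v i \<in> carrier_vec n_T" "\<And>i. i \<notin> S \<Longrightarrow> v i = 0\<^sub>v n_T"
    "(\<Sum>i<K_T. h b k i \<bullet> v i) = 1"
    "\<And>k'. k' \<in> R - {k} \<Longrightarrow> (\<Sum>i<K_T. h b k' i \<bullet> v i) = 0"
proof -
  let ?H = "channel_mat K_T K_R n_T (h b)"
  \<comment> \<open>The column of the channel matrix that belongs to antenna \<open>a\<close> of EN
    \<open>i\<close>.\<close>
  define e where "e = (\<lambda>(i, a). i * n_T + a)"
  have e_inj: "inj_on e (UNIV \<times> {..<n_T})"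
  proof (rule inj_onI, clarsimp simp: e_def)
    fix i i' a a' assume *: "a < n_T" "a' < n_T" "i * n_T + a = i' * n_T + a'"
    have "i = i'" using arg_cong[OF *(3), of "\<lambda>s. s div n_T"] *(1,2) by simp
    with * show "i = i' \<and> a = a'" by simp
  qed
  have "card (e ` (S \<times> {..<n_T})) = card S * n_T"
    using card_image[OF inj_on_subset[OF e_inj], of "S \<times> {..<n_T}"]
    by (simp add: card_cartesian_product Sigma_mono)
  \<comment> \<open>As many antennas of \<open>S\<close> as there are served users: the resulting
    submatrix is square, so nondegeneracy applies to it.\<close>
  then obtain J where J: "J \<subseteq> e ` (S \<times> {..<n_T})" "card J = card R"
    using obtain_subset_with_card_n[of "card R" "e ` (S \<times> {..<n_T})"] card by auto
  have JK: "J \<subseteq> {..<K_T * n_T}"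
  proof
    fix j assume "j \<in> J"
    then obtain i a where ia: "i \<in> S" "a < n_T" "j = i * n_T + a" using J(1) by (auto simp: e_def)
    then have "Suc i \<le> K_T" using S by auto
    then have "Suc i * n_T \<le> K_T * n_T" by (rule mult_le_mono1)
    with ia show "j \<in> {..<K_T * n_T}" by auto
  qed
  have "R \<subseteq> {..<K_R} \<and> J \<subseteq> {..<K_T * n_T} \<and> R \<noteq> {} \<and> card R = card J"
    using R JK J(2) k by auto
  then have inv: "invertible_mat (submatrix ?H R J)"
    using nd unfolding nondegenerate_def by blast
  have H: "?H \<in> carrier_mat K_R (K_T * n_T)" by (simp add: channel_mat_def)
  obtain x where x: "\<And>k'. k' \<in> R \<Longrightarrow>
      (\<Sum>j\<in>J. ?H $$ (k', j) * x j) = (if k' = k then 1 else 0)"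
    by (rule submatrix_solve[OF H R JK J(2)[symmetric] inv, where b = "\<lambda>k'. if k' = k then 1 else 0"])
      (rule that)
  \<comment> \<open>The solution for the unit vector at \<open>k\<close>, cut into one piece per EN;
    antennas not selected in \<open>J\<close> stay silent.\<close>
  define v where "v i = vec n_T (\<lambda>a. if e (i, a) \<in> J then x (e (i, a)) else 0)" for i
  have hv: "(\<Sum>i<K_T. h b k' i \<bullet> v i) = (if k' = k then 1 else 0)" if k': "k' \<in> R" for k'
  proof -
    have bound: "e (i, a) < K_T * n_T" if "i < K_T" "a < n_T" for i a
    proof -
      have "Suc i * n_T \<le> K_T * n_T" using that by (intro mult_le_mono1) simp
      with that show ?thesis by (simp add: e_def)
    qed
    have "(\<Sum>i<K_T. h b k' i \<bullet> v i)
        = (\<Sum>i<K_T. \<Sum>a<n_T. if e (i, a) \<in> J then ?H $$ (k', e (i, a)) * x (e (i, a)) else 0)"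
    proof (intro sum.cong refl)
      fix i assume i: "i \<in> {..<K_T}"
      have "?H $$ (k', e (i, a)) = h b k' i $ a" if "a < n_T" for a
        using that bound[of i a] i k' R by (auto simp: channel_mat_def) (auto simp: e_def)
      then show "h b k' i \<bullet> v i
          = (\<Sum>a<n_T. if e (i, a) \<in> J then ?H $$ (k', e (i, a)) * x (e (i, a)) else 0)"
        by (auto simp: scalar_prod_def v_def lessThan_atLeast0 intro!: sum.cong)
    qed
    also have "\<dots> = (\<Sum>z\<in>{..<K_T} \<times> {..<n_T}. if e z \<in> J then ?H $$ (k', e z) * x (e z) else 0)"
      by (simp add: sum.cartesian_product)
    also have "\<dots> = (\<Sum>j\<in>e ` ({..<K_T} \<times> {..<n_T}). if j \<in> J then ?H $$ (k', j) * x j else 0)"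
      by (rule sum.reindex[symmetric, unfolded o_def]) (rule inj_on_subset[OF e_inj], auto)
    also have "\<dots> = (\<Sum>j\<in>J. ?H $$ (k', j) * x j)"
    proof -
      have "J \<subseteq> e ` ({..<K_T} \<times> {..<n_T})" using J(1) S by blast
      then show ?thesis by (simp add: sum.inter_restrict[symmetric] Int_absorb1)
    qed
    also have "\<dots> = (if k' = k then 1 else 0)" by (rule x[OF k'])
    finally show ?thesis .
  qed
  have "v i = 0\<^sub>v n_T" if i: "i \<notin> S" for i
  proof -
    have "e (i, a) \<notin> J" if a: "a < n_T" for a
    proof
      assume "e (i, a) \<in> J"
      then obtain z where "z \<in> S \<times> {..<n_T}" "e (i, a) = e z" using J(1) by blast
      then have "(i, a) \<in> S \<times> {..<n_T}" using inj_onD[OF e_inj, of "(i, a)" z] a by auto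
      with i show False by simp
    qed
    then show ?thesis by (intro eq_vecI) (auto simp: v_def)
  qed
  then show ?thesis
    using hv k by (intro that[of v]) (auto simp: v_def)
qed

section \<open>Cyclic fronthaul placement\<close>

definition holders :: "nat \<Rightarrow> nat \<Rightarrow> nat \<Rightarrow> nat set" where
  "holders K m f = {i. i < K \<and> (\<exists>j<m. f mod K = (i + j) mod K)}"

text \<open>The ENs lying \<open>j < m\<close> places cyclically before \<open>f\<close> are all
  holders, and they are distinct because \<open>m \<le> K\<close>.\<close>

lemma card_holders:
  assumes "m \<le> K" "K \<ge> 1"
  shows "m \<le> card (holders K m f)"
proof -
  \<comment> \<open>This is \<open>f - j\<close> modulo \<open>K\<close>; adding
    \<open>K - j\<close> instead avoids truncated subtraction.\<close>
  define g where "g j = (f + (K - j)) mod K" for j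
  have g: "(g j + j) mod K = f mod K" if "j < m" for j
    using that assms by (simp add: g_def mod_add_left_eq)
  have "inj_on g {..<m}"
  proof (rule inj_onI)
    fix j j' assume "j \<in> {..<m}" "j' \<in> {..<m}" "g j = g j'"
    moreover from this have "(g j + j) mod K = (g j + j') mod K"
      using g[of j] g[of j'] by simp
    ultimately show "j = j'"
      using inj_onD[OF inj_on_mod_interval[OF assms(1), of "g j"], of "g j + j" "g j + j'"] by simp
  qed
  moreover have "g ` {..<m} \<subseteq> holders K m f"
    using g assms by (fastforce simp: holders_def g_def)
  moreover have "finite (holders K m f)" by (simp add: holders_def)
  ultimately show ?thesis
    by (metis card_image card_lessThan card_mono)
qed

definition cyclic_fronthaul ::
  "nat \<Rightarrow> nat \<Rightarrow> nat \<Rightarrow> nat \<Rightarrow> (nat \<Rightarrow> nat) \<Rightarrow> nat \<Rightarrow> packet set" where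
  "cyclic_fronthaul K_T K_R m F d i = {(d k, f) | k f. k < K_R \<and> f < F \<and> i \<in> holders K_T m f}"

text \<open>Each residue modulo \<open>K_T\<close> occurs exactly \<open>L\<close> times among the
  packet indices, and an EN takes at most \<open>m\<close> residues. Users requesting the same file
  only make the set smaller.\<close>

lemma card_cyclic_fronthaul:
  assumes "K_T \<ge> 1"
  shows "card (cyclic_fronthaul K_T K_R m (K_T * L) d i) \<le> K_R * m * L"
proof -
  let ?X = "{..<K_R} \<times> {..<m} \<times> {..<L}"
  let ?g = "\<lambda>(k, j, l). (d k, l * K_T + (i + j) mod K_T)"
  have "cyclic_fronthaul K_T K_R m (K_T * L) d i \<subseteq> ?g ` ?X"
  proof
    fix z assume "z \<in> cyclic_fronthaul K_T K_R m (K_T * L) d i"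
    then obtain k f j where z: "z = (d k, f)" "k < K_R" "f < K_T * L" "j < m"
      "f mod K_T = (i + j) mod K_T"
      by (auto simp: cyclic_fronthaul_def holders_def)
    have "f = (f div K_T) * K_T + (i + j) mod K_T"
      using z(5) div_mult_mod_eq[of f K_T] by simp
    moreover have "f div K_T < L" using z(3) by (simp add: less_mult_imp_div_less mult.commute)
    ultimately show "z \<in> ?g ` ?X"
      using z by (intro image_eqI[of _ _ "(k, j, f div K_T)"]) auto
  qed
  then have "card (cyclic_fronthaul K_T K_R m (K_T * L) d i) \<le> card (?g ` ?X)"
    by (rule card_mono[rotated]) simp
  also have "\<dots> \<le> card ?X" by (rule card_image_le) simp
  finally show ?thesis by (simp add: card_cartesian_product mult.assoc)
qed

section \<open>Block schedule and delivery\<close>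

lemma delivery_exists:
  fixes K_T K_R n_T m N :: nat and r :: real and d :: "nat \<Rightarrow> nat" and h :: channels
  defines "u \<equiv> min (m * n_T) K_R"
  assumes K: "K_T \<ge> 1" "K_R \<ge> 1" and n: "n_T \<ge> 1" and m: "1 \<le> m" "m \<le> K_T" and r: "r > 0"
    and nd: "nondegenerate K_T K_R n_T h"
  obtains D where "valid_delivery K_T K_R n_T N r (K_T * u) (\<lambda>_ _. {}) d h D"
    "fronthaul D = cyclic_fronthaul K_T K_R m (K_T * u) d" "num_blocks D = K_T * K_R"
proof -
  let ?F = "K_T * u"
  have u: "u \<ge> 1" "u \<le> K_R" "u \<le> m * n_T" using K n m by (auto simp: u_def)
  \<comment> \<open>Slot \<open>s\<close> stands for packet \<open>s div K_R\<close> of user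
    \<open>s mod K_R\<close>. There are \<open>K_R * K_T * u\<close> slots, so windows of length
    \<open>u\<close> fill exactly \<open>K_T * K_R\<close> blocks. As \<open>u \<le> K_R\<close>, no
    user occurs twice in a window, and \<open>slot b k\<close> is the slot of \<open>k\<close> in
    block \<open>b\<close>.\<close>
  define I where "I b = {b * u..<b * u + u}" for b
  define R where "R b = (\<lambda>s. s mod K_R) ` I b" for b
  define slot where "slot b = inv_into (I b) (\<lambda>s. s mod K_R)" for b
  define A where "A = cyclic_fronthaul K_T K_R m ?F d"
  have inj: "inj_on (\<lambda>s. s mod K_R) (I b)" for b
    unfolding I_def using u(2) by (rule inj_on_mod_interval)
  have R: "R b \<subseteq> {..<K_R}" "card (R b) = u" for b
    using K card_image[OF inj[of b]] by (auto simp: R_def I_def)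
  have slot: "slot b k \<in> I b" "slot b k mod K_R = k" if "k \<in> R b" for b k
    using that unfolding slot_def R_def
    by (auto intro: inv_into_into) (metis (mono_tags, lifting) f_inv_into_f image_eqI)
  have slotF: "slot b k div K_R < ?F" if "b < K_T * K_R" "k \<in> R b" for b k
  proof -
    have "slot b k < Suc b * u" using slot(1)[OF that(2)] by (auto simp: I_def)
    also have "\<dots> \<le> K_T * K_R * u" using that(1) by (intro mult_le_mono1) simp
    finally show ?thesis by (intro less_mult_imp_div_less) (simp add: mult_ac)
  qed
  define good where "good b k w \<longleftrightarrow>
      (\<forall>i. w i \<in> carrier_vec n_T) \<and>
      (\<forall>i. i \<notin> holders K_T m (slot b k div K_R) \<longrightarrow> w i = 0\<^sub>v n_T) \<and>
      (\<Sum>i<K_T. h b k i \<bullet> w i) = 1 \<and>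
      (\<forall>k'\<in>R b - {k}. (\<Sum>i<K_T. h b k' i \<bullet> w i) = 0)" for b k w
  define v where "v b k = (SOME w. good b k w)" for b k
  have v: "good b k (v b k)" if kR: "k \<in> R b" for b k
  proof -
    let ?S = "holders K_T m (slot b k div K_R)"
    have "u \<le> card ?S * n_T"
      using u(3) card_holders[OF m(2) K(1)] by (meson le_trans mult_le_mono1)
    then have "card (R b) \<le> card ?S * n_T" using R(2) by simp
    moreover have "?S \<subseteq> {..<K_T}" by (auto simp: holders_def)
    ultimately obtain w where "\<And>i. w i \<in> carrier_vec n_T" "\<And>i. i \<notin> ?S \<Longrightarrow> w i = 0\<^sub>v n_T"
      "(\<Sum>i<K_T. h b k i \<bullet> w i) = 1"
      "\<And>k'. k' \<in> R b - {k} \<Longrightarrow> (\<Sum>i<K_T. h b k' i \<bullet> w i) = 0"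
      using zero_forcing[OF nd n R(1) kR, where b = b] by blast
    then have "good b k w" by (simp add: good_def)
    then show ?thesis unfolding v_def by (rule someI[of "good b k"])
  qed
  define D where "D = \<lparr>fronthaul = A, num_blocks = K_T * K_R, served = R,
     sent = (\<lambda>b k. (d k, slot b k div K_R)), precoder = (\<lambda>b i k. v b k i)\<rparr>"
  have "valid_fronthaul K_T K_R r ?F d A"
    using r by (auto simp: valid_fronthaul_def A_def cyclic_fronthaul_def file_packets_def)
  moreover have "valid_block K_T K_R n_T ?F d (h b) (\<lambda>i. (\<Union>n<N. {}) \<union> A i)
      (R b) (\<lambda>k. (d k, slot b k div K_R)) (\<lambda>i k. v b k i)" if b: "b < K_T * K_R" for b
    unfolding valid_block_def
  proof (intro conjI ballI allI impI)
    fix k i assume k: "k \<in> R b" "(d k, slot b k div K_R) \<notin> (\<Union>n<N. {}) \<union> A i"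
    then have "i \<notin> holders K_T m (slot b k div K_R)"
      using slotF[OF b k(1)] R(1)[of b] by (auto simp: A_def cyclic_fronthaul_def)
    then show "v b k i = 0\<^sub>v n_T" using v[OF k(1)] by (simp add: good_def)
  qed (use v R(1) slotF[OF b] in \<open>auto simp: good_def file_packets_def\<close>)
  moreover have "(d k, f) \<in> {(d k, slot b k div K_R) | b. b < K_T * K_R \<and> k \<in> R b}"
    if k: "k < K_R" and f: "f < ?F" for k f
  proof -
    \<comment> \<open>The slot reserved for packet \<open>f\<close> of user \<open>k\<close>; its
      block is \<open>s div u\<close>.\<close>
    define s where "s = f * K_R + k"
    have sI: "s \<in> I (s div u)"
      using u(1) div_mult_mod_eq[of s u] mod_less_divisor[of u s] unfolding I_def
      by (simp only: atLeastLessThan_iff) linarith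
    have smod: "s mod K_R = k" "s div K_R = f" using k by (auto simp: s_def)
    have kR: "k \<in> R (s div u)" using sI smod(1) unfolding R_def by blast
    have "slot (s div u) k = s"
      unfolding slot_def using inv_into_f_f[OF inj sI] smod(1) by simp
    moreover have "s div u < K_T * K_R"
    proof -
      have "s < Suc f * K_R" using k by (simp add: s_def)
      also have "\<dots> \<le> ?F * K_R" using f by (intro mult_le_mono1) simp
      finally show ?thesis by (intro less_mult_imp_div_less) (simp add: mult_ac)
    qed
    ultimately show ?thesis using kR smod(2) by (intro CollectI exI[of _ "s div u"]) simp
  qed
  ultimately have "valid_delivery K_T K_R n_T N r ?F (\<lambda>_ _. {}) d h D"
    unfolding valid_delivery_def D_def by (auto simp: file_packets_def)
  then show ?thesis
    by (rule that) (simp_all add: D_def A_def)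
qed

section \<open>The NDT of the cyclic policy\<close>

lemma NDT_bar_zero_cache_le:
  fixes K_T K_R n_T m N :: nat and r :: real
  assumes K: "K_T \<ge> 1" "K_R \<ge> 1" and n: "n_T \<ge> 1" and m: "1 \<le> m" "m \<le> K_T" and r: "r > 0"
  shows "NDT_bar K_T K_R n_T N r 0 \<le> ereal (delta_F K_T K_R r m + delta_E K_R n_T m)"
proof -
  define u where "u = min (m * n_T) K_R"
  let ?F = "K_T * u"
  have u: "u \<ge> 1" using K n m by (auto simp: u_def)
  define good where "good d h D \<longleftrightarrow> valid_delivery K_T K_R n_T N r ?F (\<lambda>_ _. {}) d h D \<and>
      fronthaul D = cyclic_fronthaul K_T K_R m ?F d \<and> num_blocks D = K_T * K_R" for d h D
  \<comment> \<open>Choice turns the existence of a delivery for each request and channel into one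
    policy; packet number and empty caches depend on neither.\<close>
  define p where "p = \<lparr>num_packets = ?F, cache = (\<lambda>_ _. {}), deliver = (\<lambda>d h. SOME D. good d h D)\<rparr>"
  have p: "good d h (deliver p d h)" if nd: "nondegenerate K_T K_R n_T h" for d h
  proof -
    obtain D where "good d h D"
      using delivery_exists[OF assms nd] unfolding good_def u_def by metis
    then show ?thesis unfolding p_def by (simp add: someI)
  qed
  have "valid_policy K_T K_R n_T N r 0 p"
    using p K u by (auto simp: valid_policy_def valid_cache_def good_def p_def)
  then have "NDT_bar K_T K_R n_T N r 0 \<le> policy_NDT K_T K_R n_T N r p"
    unfolding NDT_bar_def by (intro INF_lower) simp
  also have "\<dots> \<le> ereal (delta_F K_T K_R r m + delta_E K_R n_T m)"
    unfolding policy_NDT_def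
  proof (intro SUP_least)
    fix d h assume "h \<in> {h. nondegenerate K_T K_R n_T h}"
    then have g: "good d h (deliver p d h)" using p by simp
    have "(MAX i\<in>{..<K_T}. card (fronthaul (deliver p d h) i)) \<le> K_R * m * u"
      using g K card_cyclic_fronthaul[OF K(1)] by (subst Max_le_iff) (auto simp: good_def lessThan_empty_iff)
    then have "fronthaul_NDT K_T r ?F (deliver p d h) \<le> real (K_R * m * u) / (real ?F * r)"
      unfolding fronthaul_NDT_def using r by (intro divide_right_mono) (auto simp del: of_nat_mult)
    \<comment> \<open>The factor \<open>u\<close> cancels against \<open>?F = K_T * u\<close>; in
      the edge term the factor \<open>K_T\<close> cancels, leaving \<open>K_R / u\<close>.\<close>
    also have "\<dots> = delta_F K_T K_R r m"
      using u K r by (simp add: delta_F_def field_simps)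
    finally have "fronthaul_NDT K_T r ?F (deliver p d h) \<le> delta_F K_T K_R r m" .
    moreover have "edge_NDT ?F (deliver p d h) = delta_E K_R n_T m"
      using g K u by (simp add: good_def edge_NDT_def delta_E_def u_def[symmetric])
    ultimately show "ereal (fronthaul_NDT K_T r (num_packets p) (deliver p d h)
        + edge_NDT (num_packets p) (deliver p d h)) \<le> ereal (delta_F K_T K_R r m + delta_E K_R n_T m)"
      by (simp add: p_def)
  qed
  finally show ?thesis .
qed

section \<open>Admissibility of the rounded multiplicity and the envelope\<close>

text \<open>\<open>M\<close> is itself a candidate for the rounding, and any integer above
  \<open>M\<close> would be strictly farther from \<open>x\<close>.\<close>

lemma nearest_pos_int_le:
  assumes "nearest_pos_int x m" and "x \<le> real M" and "M \<ge> 1"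
  shows "1 \<le> m" and "m \<le> M"
proof -
  show "1 \<le> m" using assms(1) by (simp add: nearest_pos_int_def is_arg_min_def)
  have "\<bar>x - real m\<bar> \<le> \<bar>x - real M\<bar>"
    using assms(1,3) by (auto simp: nearest_pos_int_def is_arg_min_linorder)
  with assms(2) show "m \<le> M" by linarith
qed

text \<open>The condition \<open>r < r_th K_T K_R n_T\<close> says precisely that the number under
  the root is below the square of \<open>m_max K_T K_R n_T\<close>. Rounding then cannot exceed this
  integer, which is at most \<open>K_T\<close>.\<close>

lemma m_opt_bounds:
  assumes K: "K_T \<ge> 1" "K_R \<ge> 1" and n: "n_T \<ge> 1"
    and rnd: "\<And>x. nearest_pos_int x (rnd x)"
  shows "1 \<le> m_opt rnd K_T K_R n_T r" and "m_opt rnd K_T K_R n_T r \<le> K_T"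
proof -
  let ?M = "m_max K_T K_R n_T"
  have "0 < nat \<lceil>real K_R / real n_T\<rceil>" using K n by simp
  then have M: "1 \<le> ?M" "?M \<le> K_T" using K by (auto simp: m_max_def Suc_le_eq)
  have "sqrt (real K_T * r / real n_T) \<le> real ?M" if "r < r_th K_T K_R n_T"
  proof (rule real_le_lsqrt)
    show "real K_T * r / real n_T \<le> (real ?M)\<^sup>2"
      using that K n by (simp add: r_th_def field_simps)
  qed auto
  with M show "1 \<le> m_opt rnd K_T K_R n_T r" "m_opt rnd K_T K_R n_T r \<le> K_T"
    using nearest_pos_int_le[OF rnd _ M(1)] by (auto simp: m_opt_def intro: order.trans)
qed

text \<open>Every competitor in the supremum is a minorant of \<open>f\<close> on
  \<open>S\<close>.\<close>

lemma lower_convex_envelope_le: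
  assumes "x \<in> S"
  shows "lower_convex_envelope S f x \<le> f x"
  using assms unfolding lower_convex_envelope_def by (auto intro: SUP_least)

theorem proposition2:
  fixes K_T K_R n_T N :: nat and r :: real and rnd :: "real \<Rightarrow> nat"
  assumes "K_T \<ge> 1" and "K_R \<ge> 1" and "n_T \<ge> 1" and "N \<ge> K_R"
    and "r > 0"
    and "\<And>x. nearest_pos_int x (rnd x)"
  shows "min_NDT K_T K_R n_T N 0 r
           \<le> ereal (delta_F K_T K_R r (m_opt rnd K_T K_R n_T r)
                    + delta_E K_R n_T (m_opt rnd K_T K_R n_T r))"
proof -
  have "min_NDT K_T K_R n_T N 0 r \<le> NDT_bar K_T K_R n_T N r 0"
    unfolding min_NDT_def by (rule lower_convex_envelope_le) simp
  also have "\<dots> \<le> ereal (delta_F K_T K_R r (m_opt rnd K_T K_R n_T r)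
                    + delta_E K_R n_T (m_opt rnd K_T K_R n_T r))"
    using assms m_opt_bounds by (intro NDT_bar_zero_cache_le) auto
  finally show ?thesis .
qed

end
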